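(* Let $A$ and $B$ be ccm-magmas and let $f,g\colon A\times A\to B$ be two morphisms of ccm-magmas such that $f(a,a)=g(a,a)$ for every $a\in A$. Then the internal relation $R$ on $A$ defined by \[xRy\Leftrightarrow f(x,y)=g(x,y)\] is a congruence.
   Context: A ccm-magma (commutative cancellative medial magma) is a set $A$ with a binary operation $\oplus$ such that for all $a,b,c,d\in A$: (M1) $a\oplus b=b\oplus a$; (M2) $a\oplus c=b\oplus c$ implies $a=b$; (M3) $(a\oplus b)\oplus(c\oplus d)=(a\oplus c)\oplus(b\oplus d)$. A morphism of ccm-magmas is a map preserving the binary operation. Products carry the componentwise operation. An internal relation on $A$ is a subalgebra of $A\times A$ (a subset closed under $\oplus$). A congruence on $A$ is a subalgebra of $A\times A$ which, considered as a relation, is reflexive, transitive and symmetric. *)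

theory Defs
  imports "HOL-Library.FuncSet"
begin

text \<open>The carrier may be empty, and the operation is constrained on the carrier only.\<close>

locale ccm_magma =
  fixes A :: "'a set" and add :: "'a \<Rightarrow> 'a \<Rightarrow> 'a" (infixl "\<oplus>" 65)
  assumes closed: "\<lbrakk>a \<in> A; b \<in> A\<rbrakk> \<Longrightarrow> a \<oplus> b \<in> A"
    and commutative: "\<lbrakk>a \<in> A; b \<in> A\<rbrakk> \<Longrightarrow> a \<oplus> b = b \<oplus> a"
    and cancellative: "\<lbrakk>a \<in> A; b \<in> A; c \<in> A; a \<oplus> c = b \<oplus> c\<rbrakk> \<Longrightarrow> a = b"
    and medial: "\<lbrakk>a \<in> A; b \<in> A; c \<in> A; d \<in> A\<rbrakk>
      \<Longrightarrow> (a \<oplus> b) \<oplus> (c \<oplus> d) = (a \<oplus> c) \<oplus> (b \<oplus> d)"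

definition prod_op :: "('a \<Rightarrow> 'a \<Rightarrow> 'a) \<Rightarrow> ('b \<Rightarrow> 'b \<Rightarrow> 'b) \<Rightarrow> 'a \<times> 'b \<Rightarrow> 'a \<times> 'b \<Rightarrow> 'a \<times> 'b"
  where "prod_op add1 add2 p q = (add1 (fst p) (fst q), add2 (snd p) (snd q))"

definition magma_hom ::
  "'a set \<Rightarrow> ('a \<Rightarrow> 'a \<Rightarrow> 'a) \<Rightarrow> 'b set \<Rightarrow> ('b \<Rightarrow> 'b \<Rightarrow> 'b) \<Rightarrow> ('a \<Rightarrow> 'b) \<Rightarrow> bool"
  where "magma_hom A addA B addB f \<longleftrightarrow>
    f \<in> A \<rightarrow> B \<and> (\<forall>x\<in>A. \<forall>y\<in>A. f (addA x y) = addB (f x) (f y))"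

definition subalgebra :: "'a set \<Rightarrow> 'a set \<Rightarrow> ('a \<Rightarrow> 'a \<Rightarrow> 'a) \<Rightarrow> bool"
  where "subalgebra S A add \<longleftrightarrow> S \<subseteq> A \<and> (\<forall>x\<in>S. \<forall>y\<in>S. add x y \<in> S)"

definition internal_relation :: "'a set \<Rightarrow> ('a \<Rightarrow> 'a \<Rightarrow> 'a) \<Rightarrow> ('a \<times> 'a) set \<Rightarrow> bool"
  where "internal_relation A add R \<longleftrightarrow> subalgebra R (A \<times> A) (prod_op add add)"

definition congruence :: "'a set \<Rightarrow> ('a \<Rightarrow> 'a \<Rightarrow> 'a) \<Rightarrow> ('a \<times> 'a) set \<Rightarrow> bool"
  where "congruence A add R \<longleftrightarrow>
    internal_relation A add R \<and> refl_on A R \<and> trans R \<and> sym R"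

lemma ccm_magma_prod:
  assumes "ccm_magma A addA" and "ccm_magma B addB"
  shows "ccm_magma (A \<times> B) (prod_op addA addB)"
proof -
  interpret A: ccm_magma A addA by fact
  interpret B: ccm_magma B addB by fact
  show ?thesis
  proof
    fix p q r s
    assume p: "p \<in> A \<times> B" and q: "q \<in> A \<times> B"
    show "prod_op addA addB p q \<in> A \<times> B"
      using p q by (auto simp: prod_op_def A.closed B.closed)
    show "prod_op addA addB p q = prod_op addA addB q p"
      using p q A.commutative[of "fst p" "fst q"] B.commutative[of "snd p" "snd q"]
      by (auto simp: prod_op_def mem_Times_iff)
    assume r: "r \<in> A \<times> B"
    show "p = q" if "prod_op addA addB p r = prod_op addA addB q r"
      using that p q r A.cancellative[of "fst p" "fst q" "fst r"]
        B.cancellative[of "snd p" "snd q" "snd r"]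
      by (simp add: prod_op_def mem_Times_iff prod_eq_iff)
    assume s: "s \<in> A \<times> B"
    show "prod_op addA addB (prod_op addA addB p q) (prod_op addA addB r s) =
        prod_op addA addB (prod_op addA addB p r) (prod_op addA addB q s)"
      using p q r s A.medial[of "fst p" "fst q" "fst r" "fst s"]
        B.medial[of "snd p" "snd q" "snd r" "snd s"]
      by (simp add: prod_op_def mem_Times_iff)
  qed
qed

end

theory Submission
  imports Defs
begin

text \<open>
  The pairs on which \<open>f\<close> and \<open>g\<close> agree form the equalizer of two morphisms into a cancellative
  magma. Such an equalizer is closed under the operation, and it also allows division: if it
  contains \<open>p\<close> and \<open>p \<oplus> q\<close>, it contains \<open>q\<close> (\<open>hom_agree_cancel\<close>). It contains the diagonal by
  hypothesis, and commutativity of \<open>A\<close> gives two identities in \<open>A \<times> A\<close>,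
  \<open>(x, y) \<oplus> (y, x) = (x \<oplus> y, x \<oplus> y)\<close> and \<open>(y, y) \<oplus> (x, z) = (x, y) \<oplus> (y, z)\<close>.
  In the first the sum is diagonal, so division by \<open>(x, y)\<close> yields symmetry; in the second the
  sum lies in the equalizer by closure, so division by \<open>(y, y)\<close> yields transitivity.
\<close>

lemma hom_agree_add:
  assumes "magma_hom M addM B addB f" and "magma_hom M addM B addB g"
    and "p \<in> M" and "q \<in> M" and "f p = g p" and "f q = g q"
  shows "f (addM p q) = g (addM p q)"
  using assms by (simp add: magma_hom_def)

text \<open>
  The images of \<open>addM p q\<close> are \<open>addB (f p) (f q)\<close> and \<open>addB (g p) (g q)\<close>, whose common
  summand \<open>f p = g p\<close> can be cancelled.
\<close>

lemma hom_agree_cancel: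
  assumes B: "ccm_magma B addB"
    and f: "magma_hom M addM B addB f" and g: "magma_hom M addM B addB g"
    and p: "p \<in> M" and q: "q \<in> M"
    and eq_p: "f p = g p" and eq_sum: "f (addM p q) = g (addM p q)"
  shows "f q = g q"
proof -
  interpret B: ccm_magma B addB by fact
  have mem: "f p \<in> B" "f q \<in> B" "g q \<in> B"
    using f g p q by (auto simp: magma_hom_def)
  have "addB (f p) (f q) = addB (f p) (g q)"
    using f g p q eq_p eq_sum by (simp add: magma_hom_def)
  then have "addB (f q) (f p) = addB (g q) (f p)"
    using mem by (simp add: B.commutative)
  then show ?thesis
    using mem B.cancellative by blast
qed

theorem proposition6p1:
  fixes A :: "'a set" and addA :: "'a \<Rightarrow> 'a \<Rightarrow> 'a"
    and B :: "'b set" and addB :: "'b \<Rightarrow> 'b \<Rightarrow> 'b"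
    and f g :: "'a \<times> 'a \<Rightarrow> 'b"
  assumes "ccm_magma A addA"
    and "ccm_magma B addB"
    and "magma_hom (A \<times> A) (prod_op addA addA) B addB f"
    and "magma_hom (A \<times> A) (prod_op addA addA) B addB g"
    and "\<And>a. a \<in> A \<Longrightarrow> f (a, a) = g (a, a)"
  shows "congruence A addA {(x, y). x \<in> A \<and> y \<in> A \<and> f (x, y) = g (x, y)}"
    (is "congruence A addA ?R")
proof -
  interpret A: ccm_magma A addA by fact
  note add = hom_agree_add[OF assms(3,4)]
  note cancel = hom_agree_cancel[OF assms(2-4)]
  have "prod_op addA addA p q \<in> ?R" if "p \<in> ?R" and "q \<in> ?R" for p q
    using that add[of p q] by (auto simp: prod_op_def A.closed)
  then have "internal_relation A addA ?R"
    by (auto simp: internal_relation_def subalgebra_def)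
  moreover have "refl_on A ?R"
    using assms(5) by (auto simp: refl_on_def)
  moreover have "sym ?R"
  proof (rule symI)
    fix x y
    assume "(x, y) \<in> ?R"
    then have xy: "x \<in> A" "y \<in> A" "f (x, y) = g (x, y)" by auto
    have "prod_op addA addA (x, y) (y, x) = (addA x y, addA x y)"
      using xy by (simp add: prod_op_def A.commutative)
    then have "f (y, x) = g (y, x)"
      using cancel[of "(x, y)" "(y, x)"] xy assms(5) A.closed by simp
    then show "(y, x) \<in> ?R" using xy by simp
  qed
  moreover have "trans ?R"
  proof (rule transI)
    fix x y z
    assume "(x, y) \<in> ?R" and "(y, z) \<in> ?R"
    then have xyz: "x \<in> A" "y \<in> A" "z \<in> A" "f (x, y) = g (x, y)" "f (y, z) = g (y, z)"
      by auto
    have "prod_op addA addA (y, y) (x, z) = prod_op addA addA (x, y) (y, z)"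
      using xyz by (simp add: prod_op_def A.commutative)
    then have "f (x, z) = g (x, z)"
      using cancel[of "(y, y)" "(x, z)"] add[of "(x, y)" "(y, z)"] xyz assms(5) by simp
    then show "(x, z) \<in> ?R" using xyz by simp
  qed
  ultimately show ?thesis by (simp add: congruence_def)
qed

end
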